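(* Let $m,n$ be positive integers and consider the $m\times n$ table. For all integers $1\leq s,t\leq m$ with $s\leq n$, $$\mathcal{C}^1(s,t)=\sum_{i=0}^{\lfloor\frac{s-t}{2}\rfloor}\binom{s-1}{s-t-2i}\,\mathcal{A}(t+2i,t).$$
   Context: The $m\times n$ table has $m$ rows and $n$ columns; the $(x,y)$-cell is the cell in column $x$ and row $y$, $1\leq x\leq n$, $1\leq y\leq m$. A lattice path inside the table is a sequence of cells of the table in which consecutive cells differ by an allowed step. $\mathcal{C}^1(s,t)$ is the number of lattice paths inside the table from the $(1,1)$-cell to the $(s,t)$-cell with steps in $\{(1,1),(1,0),(1,-1)\}$. $\mathcal{A}(s,t)$ is the number of lattice paths inside the table from the $(1,1)$-cell to the $(s,t)$-cell using only the steps $(1,1)$ and $(1,-1)$. A sum whose upper limit is less than its lower limit is $0$. *)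

theory Defs
  imports Complex_Main "HOL-Library.Product_Plus"
begin

text \<open>A cell is a pair (column, row).\<close>

type_synonym cell = "int \<times> int"

definition table :: "nat \<Rightarrow> nat \<Rightarrow> cell set" where
  "table m n = {1..int n} \<times> {1..int m}"

text \<open>Paths are recorded as their sequences of cells, so the one-cell path is a path
  from a cell to itself.\<close>

definition lattice_paths :: "cell set \<Rightarrow> cell set \<Rightarrow> cell \<Rightarrow> cell \<Rightarrow> cell list set" where
  "lattice_paths T S a b =
     {p. p \<noteq> [] \<and> set p \<subseteq> T \<and> hd p = a \<and> last p = b \<and> successively (\<lambda>c d. d - c \<in> S) p}"

text \<open>For the step sets below every step increases the column by one, so the sets of paths are
  finite and \<^const>\<open>card\<close> is a genuine count.\<close>

definition C1 :: "nat \<Rightarrow> nat \<Rightarrow> int \<Rightarrow> int \<Rightarrow> nat" where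
  "C1 m n s t = card (lattice_paths (table m n) {(1, 1), (1, 0), (1, -1)} (1, 1) (s, t))"

definition A :: "nat \<Rightarrow> nat \<Rightarrow> int \<Rightarrow> int \<Rightarrow> nat" where
  "A m n s t = card (lattice_paths (table m n) {(1, 1), (1, -1)} (1, 1) (s, t))"

end

theory Submission
  imports Defs
begin

text \<open>Deleting the horizontal steps of a path leaves a diagonal path with the same rows, so a path
  with \<open>k\<close> steps is a diagonal path with \<open>j\<close> steps together with the positions of these steps among
  the \<open>k\<close>. In terms of last-step recursions: diagonal steps act on the vector of path counts, indexed
  by the final row, by an operator \<open>B\<close>, all three steps act by \<open>1 + B\<close>, and
  \<open>(1 + B)^k = (\<Sum>j\<le>k. (k choose j) B^j)\<close>. The diagonal paths to row \<open>t\<close> exist only if the number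
  of steps is at least \<open>t - 1\<close> and of the same parity.\<close>

text \<open>Cut off the last cell: \<open>d\<close> is the final step. Since
  \<open>a \<noteq> b\<close> excludes the one-cell path, what remains is nonempty and still starts
  at \<open>a\<close>.\<close>

lemma lattice_paths_snoc:
  assumes "b \<in> T" "a \<noteq> b"
  shows "lattice_paths T S a b = (\<Union>d\<in>S. (\<lambda>p. p @ [b]) ` lattice_paths T S a (b - d))"
proof (intro equalityI subsetI)
  fix p assume p: "p \<in> lattice_paths T S a b"
  then have "p = butlast p @ [b]" by (auto simp: lattice_paths_def)
  then obtain q where q: "p = q @ [b]" by blast
  with p assms have "q \<noteq> []" by (auto simp: lattice_paths_def)
  with p q have "b - last q \<in> S" "q \<in> lattice_paths T S a (last q)"
    by (auto simp: lattice_paths_def successively_append_iff)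
  then have "q \<in> lattice_paths T S a (b - (b - last q))" by simp
  with q \<open>b - last q \<in> S\<close> show "p \<in> (\<Union>d\<in>S. (\<lambda>p. p @ [b]) ` lattice_paths T S a (b - d))"
    by blast
next
  fix p assume "p \<in> (\<Union>d\<in>S. (\<lambda>p. p @ [b]) ` lattice_paths T S a (b - d))"
  with assms show "p \<in> lattice_paths T S a b"
    by (auto simp: lattice_paths_def successively_append_iff)
qed

lemma lattice_paths_outside: "b \<notin> T \<Longrightarrow> lattice_paths T S a b = {}"
  unfolding lattice_paths_def using last_in_set by blast

text \<open>Every step advances one column, so a step set is given by its row increments
  \<open>D\<close>, and the number \<open>k\<close> of steps fixes the final column
  \<open>1 + k\<close>. This allows induction on \<open>k\<close>.\<close>

definition row_paths :: "nat \<Rightarrow> nat \<Rightarrow> int set \<Rightarrow> nat \<Rightarrow> int \<Rightarrow> cell list set" where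
  "row_paths m n D k y = lattice_paths (table m n) (Pair 1 ` D) (1, 1) (1 + int k, y)"

lemma row_paths_0:
  assumes "m \<ge> 1" "n \<ge> 1"
  shows "row_paths m n D 0 y = (if y = 1 then {[(1, 1)]} else {})"
proof (cases "y = 1")
  case True
  have "p = [(1, 1)]"
    if p: "p \<in> lattice_paths (table m n) (Pair 1 ` D) (1, 1) (1, 1)" for p
  proof (cases p rule: rev_cases)
    case (snoc q b)
    \<comment> \<open>A predecessor of \<open>(1, 1)\<close> would lie in column 0, outside the
      table.\<close>
    have "q = []"
    proof (rule ccontr)
      assume "q \<noteq> []"
      with p snoc have "b - last q \<in> Pair 1 ` D" "b = (1, 1)" "last q \<in> table m n"
        by (auto simp: lattice_paths_def successively_append_iff)
      then show False by (auto simp: table_def minus_prod_def)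
    qed
    with p snoc show ?thesis by (auto simp: lattice_paths_def)
  qed (use p in \<open>simp add: lattice_paths_def\<close>)
  with True assms show ?thesis
    by (auto simp: row_paths_def lattice_paths_def table_def)
next
  case False
  have "row_paths m n D 0 y = {}"
  proof (cases "(1, y) \<in> table m n")
    case True
    with False have "row_paths m n D 0 y = (\<Union>d\<in>D. (\<lambda>p. p @ [(1, y)]) `
        lattice_paths (table m n) (Pair 1 ` D) (1, 1) (0, y - d))"
      by (simp add: row_paths_def lattice_paths_snoc)
    moreover have "lattice_paths (table m n) (Pair 1 ` D) (1, 1) (0, y - d) = {}" for d
      by (rule lattice_paths_outside) (simp add: table_def)
    ultimately show ?thesis by simp
  qed (simp add: row_paths_def lattice_paths_outside)
  with False show ?thesis by simp
qed

lemma row_paths_Suc: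
  assumes "Suc k < n"
  shows "row_paths m n D (Suc k) y =
    (if y \<in> {1..int m}
     then \<Union>d\<in>D. (\<lambda>p. p @ [(2 + int k, y)]) ` row_paths m n D k (y - d) else {})"
proof (cases "y \<in> {1..int m}")
  case True
  with assms have "(2 + int k, y) \<in> table m n" by (auto simp: table_def)
  with True show ?thesis by (simp add: row_paths_def lattice_paths_snoc)
next
  case False
  then show ?thesis
    by (auto simp: row_paths_def table_def intro!: lattice_paths_outside)
qed

lemma finite_row_paths:
  assumes "finite D" "m \<ge> 1" "k < n"
  shows "finite (row_paths m n D k y)"
  using assms(3)
proof (induction k arbitrary: y)
  case 0
  with assms(2) show ?case by (simp add: row_paths_0)
next
  case (Suc k)
  with assms(1) show ?case by (simp add: row_paths_Suc)
qed

lemma card_row_paths_Suc: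
  assumes "finite D" "m \<ge> 1" "Suc k < n"
  shows "card (row_paths m n D (Suc k) y) =
    (if y \<in> {1..int m} then \<Sum>d\<in>D. card (row_paths m n D k (y - d)) else 0)"
proof -
  have "card (\<Union>d\<in>D. (\<lambda>p. p @ [(2 + int k, y)]) ` row_paths m n D k (y - d))
      = (\<Sum>d\<in>D. card ((\<lambda>p. p @ [(2 + int k, y)]) ` row_paths m n D k (y - d)))"
    using assms
    \<comment> \<open>The images are disjoint because the last cell but one, in row
      \<open>y - d\<close>, determines \<open>d\<close>.\<close>
    by (intro card_UN_disjoint)
       (auto simp: finite_row_paths, auto simp: row_paths_def lattice_paths_def)
  also have "\<dots> = (\<Sum>d\<in>D. card (row_paths m n D k (y - d)))"
    by (intro sum.cong refl card_image) (simp add: inj_on_def)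
  finally show ?thesis using assms(3) by (simp add: row_paths_Suc)
qed

text \<open>Pascal's rule, in the form that turns the expansion of \<open>(1 + B)^k\<close> into
  that of \<open>(1 + B)^(k + 1)\<close>.\<close>

lemma sum_Suc_choose:
  fixes a :: "nat \<Rightarrow> nat"
  shows "(\<Sum>j\<le>Suc k. (Suc k choose j) * a j) = (\<Sum>j\<le>k. (k choose j) * (a j + a (Suc j)))"
proof -
  \<comment> \<open>The summand for \<open>j = Suc k\<close> on the right vanishes, so the right
    side is also the sum over \<open>j \<le> k\<close>.\<close>
  have "(\<Sum>j\<le>k. (k choose Suc j) * a (Suc j)) + a 0 = (\<Sum>j\<le>Suc k. (k choose j) * a j)"
    by (subst sum.atMost_Suc_shift) simp
  then show ?thesis
    by (subst sum.atMost_Suc_shift) (simp add: algebra_simps sum.distrib)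
qed

text \<open>The expansion of \<open>(1 + B)^k\<close>, by induction on \<open>k\<close>: the
  increment \<open>0\<close> contributes the summand 1 and \<open>D\<close> contributes
  \<open>B\<close>. The row \<open>y\<close> varies because the last step may come from any row
  \<open>y - d\<close>. Cutting off at the table's border is part of \<open>B\<close>; a horizontal
  step never leaves the rows of the table.\<close>

lemma card_row_paths_insert_0:
  assumes "finite D" "0 \<notin> D" "m \<ge> 1" "k < n"
  shows "card (row_paths m n (insert 0 D) k y) =
    (\<Sum>j\<le>k. (k choose j) * card (row_paths m n D j y))"
  using assms(4)
proof (induction k arbitrary: y)
  case 0
  with assms(3) show ?case by (simp add: row_paths_0)
next
  case (Suc k)
  show ?case
  proof (cases "y \<in> {1..int m}")
    case True
    have "card (row_paths m n (insert 0 D) (Suc k) y)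
        = card (row_paths m n (insert 0 D) k y)
          + (\<Sum>d\<in>D. card (row_paths m n (insert 0 D) k (y - d)))"
      using assms True Suc.prems by (simp add: card_row_paths_Suc)
    also have "\<dots> = (\<Sum>j\<le>k. (k choose j) * card (row_paths m n D j y))
        + (\<Sum>d\<in>D. \<Sum>j\<le>k. (k choose j) * card (row_paths m n D j (y - d)))"
      using Suc by simp
    also have "\<dots> = (\<Sum>j\<le>k. (k choose j) *
        (card (row_paths m n D j y) + (\<Sum>d\<in>D. card (row_paths m n D j (y - d)))))"
      by (simp add: sum.swap[of _ "{..k}" D] sum_distrib_left distrib_left sum.distrib)
    also have "\<dots> = (\<Sum>j\<le>k. (k choose j) *
        (card (row_paths m n D j y) + card (row_paths m n D (Suc j) y)))"
      using assms True Suc.prems by (intro sum.cong refl) (simp add: card_row_paths_Suc)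
    finally show ?thesis by (simp only: sum_Suc_choose)
  next
    \<comment> \<open>Outside the rows of the table both sides vanish, term by term.\<close>
    case False
    then have "row_paths m n E j y = {}" for E j
      by (auto simp: row_paths_def table_def intro!: lattice_paths_outside)
    then show ?thesis by simp
  qed
qed

text \<open>Each diagonal step raises the row by at most one and flips its parity.\<close>

lemma diagonal_row_paths_support:
  assumes "m \<ge> 1" "k < n" "row_paths m n {1, -1} k y \<noteq> {}"
  shows "y \<le> 1 + int k \<and> even (1 + int k - y)"
  using assms(2,3)
proof (induction k arbitrary: y)
  case 0
  with assms(1) show ?case by (auto simp: row_paths_0 split: if_splits)
next
  case (Suc k)
  then have "row_paths m n {1, -1} k (y - 1) \<noteq> {} \<or> row_paths m n {1, -1} k (y + 1) \<noteq> {}"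
    by (auto simp: row_paths_Suc split: if_splits)
  then show ?case
  proof
    assume "row_paths m n {1, -1} k (y - 1) \<noteq> {}"
    with Suc.IH[of "y - 1"] Suc.prems(1) show ?case by simp
  next
    assume "row_paths m n {1, -1} k (y + 1) \<noteq> {}"
    with Suc.IH[of "y + 1"] Suc.prems(1) show ?case by simp
  qed
qed

theorem theorem2p1:
  fixes m n :: nat and s t :: int
  assumes "m \<ge> 1" and "n \<ge> 1"
    and "1 \<le> s" and "s \<le> int m" and "1 \<le> t" and "t \<le> int m"
    and "s \<le> int n"
  shows "C1 m n s t =
    (\<Sum>i = 0..\<lfloor>real_of_int (s - t) / 2\<rfloor>.
       (nat (s - 1) choose nat (s - t - 2 * i)) * A m n (t + 2 * i) t)"
proof -
  define k where "k = nat (s - 1)"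
  have s: "s = 1 + int k" and k: "k < n" using assms by (auto simp: k_def)
  define a where "a j = card (row_paths m n {1, -1} j t)" for j
  have "{(1, 1), (1, 0), (1, -1)} = Pair (1 :: int) ` insert 0 {1, -1 :: int}" by auto
  then have "C1 m n s t = card (row_paths m n (insert 0 {1, -1}) k t)"
    unfolding C1_def row_paths_def s by simp
  also have "\<dots> = (\<Sum>j\<le>k. (k choose j) * a j)"
    unfolding a_def using assms(1) k by (intro card_row_paths_insert_0) auto
  also have "\<dots> = (\<Sum>j | j \<le> k \<and> t \<le> 1 + int j \<and> even (1 + int j - t). (k choose j) * a j)"
  proof (intro sum.mono_neutral_right ballI)
    fix j assume "j \<in> {..k} - {j. j \<le> k \<and> t \<le> 1 + int j \<and> even (1 + int j - t)}"
    with diagonal_row_paths_support[OF assms(1), of j n t] k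
    have "row_paths m n {1, -1} j t = {}" by fastforce
    then show "(k choose j) * a j = 0" by (simp add: a_def)
  qed auto
  also have "\<dots> = (\<Sum>i = 0..(s - t) div 2.
       (k choose nat (s - t - 2 * i)) * A m n (t + 2 * i) t)"
  \<comment> \<open>A path counted by \<open>A m n (t + 2 * i) t\<close> has
    \<open>j = t + 2 * i - 1\<close> steps.\<close>
  proof (rule sum.reindex_bij_witness[of _ "\<lambda>i. nat (t + 2 * i - 1)" "\<lambda>j. (1 + int j - t) div 2"])
    fix j assume "j \<in> {j. j \<le> k \<and> t \<le> 1 + int j \<and> even (1 + int j - t)}"
    then have j: "j \<le> k" "t \<le> 1 + int j" "2 * ((1 + int j - t) div 2) = 1 + int j - t" by auto
    then show "nat (t + 2 * ((1 + int j - t) div 2) - 1) = j"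
      "(1 + int j - t) div 2 \<in> {0..(s - t) div 2}" by (auto simp: s)
    \<comment> \<open>The lower index in the claim counts the \<open>k - j\<close> horizontal steps,
      hence the use of binomial symmetry below.\<close>
    have "nat (s - t - 2 * ((1 + int j - t) div 2)) = k - j" using j by (simp add: s)
    moreover have "A m n (t + 2 * ((1 + int j - t) div 2)) t = a j"
      unfolding j(3) by (simp add: A_def a_def row_paths_def)
    ultimately show "(k choose nat (s - t - 2 * ((1 + int j - t) div 2))) *
        A m n (t + 2 * ((1 + int j - t) div 2)) t = (k choose j) * a j"
      using j(1) by (simp add: binomial_symmetric[of j])
  next
    fix i assume "i \<in> {0..(s - t) div 2}"
    then have "0 \<le> i" "2 * i \<le> s - t" by auto
    with assms(5) have i: "1 + int (nat (t + 2 * i - 1)) - t = 2 * i"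
      "nat (t + 2 * i - 1) \<le> k" "t \<le> 1 + int (nat (t + 2 * i - 1))"
      by (auto simp: s)
    show "(1 + int (nat (t + 2 * i - 1)) - t) div 2 = i"
      "nat (t + 2 * i - 1) \<in> {j. j \<le> k \<and> t \<le> 1 + int j \<and> even (1 + int j - t)}"
      unfolding mem_Collect_eq i(1) using i(2,3) by simp_all
  qed
  \<comment> \<open>Integer \<open>div\<close> rounds down for negative \<open>s - t\<close> too, so
    the case \<open>s < t\<close> gives the empty sum on both sides.\<close>
  also have "(s - t) div 2 = \<lfloor>real_of_int (s - t) / 2\<rfloor>"
    using floor_divide_of_int_eq[of "s - t" 2, where ?'a = real] by simp
  finally show ?thesis unfolding k_def .
qed

end
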